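(* Let $(L,[\cdot,\cdot]_L,\alpha)$ and $(\Gamma,[\cdot,\cdot]_\Gamma,\beta)$ be hom-Lie superalgebras over a field $\mathbf K$ and let $\phi:L\to\Gamma$ be an even linear map. Then $\phi$ is a morphism of hom-Lie superalgebras if and only if its graph $\mathfrak G_\phi=\{u+\phi(u):u\in L\}\subset L\oplus\Gamma$ is a hom-Lie sub-superalgebra of $(L\oplus\Gamma,[\cdot,\cdot]_{L\oplus\Gamma},\alpha+\beta)$.
   Context: A hom-Lie superalgebra is a triple $(L,[\cdot,\cdot]_L,\alpha)$ with $L=L_{\bar 0}\oplus L_{\bar 1}$ a $\mathbb Z_2$-graded vector space over a field ($|x|$ is the degree of homogeneous $x$), $[\cdot,\cdot]_L:L\times L\to L$ an even bilinear map and $\alpha:L\to L$ an even linear map such that for all homogeneous $x,y,z$: $[x,y]_L=-(-1)^{|x||y|}[y,x]_L$ and $$(-1)^{|x||z|}[\alpha(x),[y,z]_L]_L+(-1)^{|y||x|}[\alpha(y),[z,x]_L]_L+(-1)^{|z||y|}[\alpha(z),[x,y]_L]_L=0.$$ A (graded) subspace $I\subset L$ is a hom-Lie sub-superalgebra if $\alpha(I)\subset I$ and $[I,I]_L\subset I$. A morphism of hom-Lie superalgebras $(L,[\cdot,\cdot]_L,\alpha)\to(\Gamma,[\cdot,\cdot]_\Gamma,\beta)$ is an even linear map $\phi$ with $\phi([u,v]_L)=[\phi(u),\phi(v)]_\Gamma$ for all $u,v\in L$ and $\phi\circ\alpha=\beta\circ\phi$. The direct sum hom-Lie superalgebra $(L\oplus\Gamma,[\cdot,\cdot]_{L\oplus\Gamma},\alpha+\beta)$,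 graded by $(L\oplus\Gamma)_\theta=L_\theta\oplus\Gamma_\theta$, has bracket $[u_1+v_1,u_2+v_2]_{L\oplus\Gamma}=[u_1,u_2]_L+[v_1,v_2]_\Gamma$ and twist $(\alpha+\beta)(u+v)=\alpha(u)+\beta(v)$. *)

theory Defs
  imports "HOL-Analysis.Product_Vector" "HOL-Library.Z2"
begin

text \<open>A grading is a family \<open>V :: bit \<Rightarrow> 'v set\<close>, where \<open>bit\<close> is the two-element field, so that degrees
  are added and multiplied modulo 2. Degrees are not a function of the vector (\<open>0\<close> lies in both
  components): identities involving degrees are quantified over \<open>a\<close> and \<open>x \<in> V a\<close>.\<close>

locale super_vector_space = vector_space scale
  for scale :: "'k::field \<Rightarrow> 'v::ab_group_add \<Rightarrow> 'v" +
  fixes V :: "bit \<Rightarrow> 'v set"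
  assumes subspace_component: "subspace (V a)"
    and component_Int: "V 0 \<inter> V 1 = {0}"
    and component_sum: "\<exists>y\<in>V 0. \<exists>z\<in>V 1. x = y + z"
begin

definition graded_subspace :: "'v set \<Rightarrow> bool"
  where "graded_subspace I \<longleftrightarrow>
    subspace I \<and> (\<forall>x\<in>I. \<exists>y\<in>I \<inter> V 0. \<exists>z\<in>I \<inter> V 1. x = y + z)"

end

locale even_linear_map =
  dom: super_vector_space scale1 V1 + cod: super_vector_space scale2 V2 +
  Vector_Spaces.linear scale1 scale2 f
  for scale1 :: "'k::field \<Rightarrow> 'v::ab_group_add \<Rightarrow> 'v" and V1
    and scale2 :: "'k \<Rightarrow> 'w::ab_group_add \<Rightarrow> 'w" and V2
    and f :: "'v \<Rightarrow> 'w" +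
  assumes even: "x \<in> V1 a \<Longrightarrow> f x \<in> V2 a"

text \<open>The scalar \<open>(-1)\<^sup>d\<close> for a degree \<open>d\<close>.\<close>

definition parity_sign :: "bit \<Rightarrow> 'k::field"
  where "parity_sign d = (if d = 0 then 1 else - 1)"

locale hom_lie_superalgebra =
  super_vector_space scale V + twist: even_linear_map scale V scale V \<alpha>
  for scale :: "'k::field \<Rightarrow> 'v::ab_group_add \<Rightarrow> 'v"
    and V :: "bit \<Rightarrow> 'v set"
    and br :: "'v \<Rightarrow> 'v \<Rightarrow> 'v"
    and \<alpha> :: "'v \<Rightarrow> 'v" +
  assumes linear_br_right: "Vector_Spaces.linear scale scale (br x)"
    and linear_br_left: "Vector_Spaces.linear scale scale (\<lambda>x. br x y)"
    and br_even: "x \<in> V a \<Longrightarrow> y \<in> V b \<Longrightarrow> br x y \<in> V (a + b)"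
    and super_skew_symmetric:
      "x \<in> V a \<Longrightarrow> y \<in> V b \<Longrightarrow> br x y = - scale (parity_sign (a * b)) (br y x)"
    and hom_Jacobi:
      "x \<in> V a \<Longrightarrow> y \<in> V b \<Longrightarrow> z \<in> V c \<Longrightarrow>
        scale (parity_sign (a * c)) (br (\<alpha> x) (br y z))
        + scale (parity_sign (b * a)) (br (\<alpha> y) (br z x))
        + scale (parity_sign (c * b)) (br (\<alpha> z) (br x y)) = 0"

locale hom_lie_sub_superalgebra = hom_lie_superalgebra scale V br \<alpha>
  for scale :: "'k::field \<Rightarrow> 'v::ab_group_add \<Rightarrow> 'v"
    and V br \<alpha> +
  fixes I :: "'v set"
  assumes graded_subspace: "graded_subspace I"
    and twist_closed: "\<alpha> ` I \<subseteq> I"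
    and br_closed: "x \<in> I \<Longrightarrow> y \<in> I \<Longrightarrow> br x y \<in> I"

locale hom_lie_superalgebra_morphism =
  L: hom_lie_superalgebra scale1 V1 br1 \<alpha> +
  G: hom_lie_superalgebra scale2 V2 br2 \<beta> +
  even_linear_map scale1 V1 scale2 V2 \<phi>
  for scale1 :: "'k::field \<Rightarrow> 'v::ab_group_add \<Rightarrow> 'v" and V1 br1 \<alpha>
    and scale2 :: "'k \<Rightarrow> 'w::ab_group_add \<Rightarrow> 'w" and V2 br2 \<beta>
    and \<phi> :: "'v \<Rightarrow> 'w" +
  assumes preserves_br: "\<phi> (br1 u v) = br2 (\<phi> u) (\<phi> v)"
    and commutes_twist: "\<phi> \<circ> \<alpha> = \<beta> \<circ> \<phi>"

text \<open>The direct sum lives on the product type, \<open>u + v\<close> being the pair \<open>(u, v)\<close>. Its scalar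
  multiplication is \<^const>\<open>module_prod.scale\<close> and its twist is \<^const>\<open>map_prod\<close>.\<close>

definition direct_sum_grading :: "(bit \<Rightarrow> 'v set) \<Rightarrow> (bit \<Rightarrow> 'w set) \<Rightarrow> bit \<Rightarrow> ('v \<times> 'w) set"
  where "direct_sum_grading V1 V2 a = V1 a \<times> V2 a"

definition direct_sum_bracket ::
    "('v \<Rightarrow> 'v \<Rightarrow> 'v) \<Rightarrow> ('w \<Rightarrow> 'w \<Rightarrow> 'w) \<Rightarrow> 'v \<times> 'w \<Rightarrow> 'v \<times> 'w \<Rightarrow> 'v \<times> 'w"
  where "direct_sum_bracket br1 br2 p q = (br1 (fst p) (fst q), br2 (snd p) (snd q))"

definition graph_of :: "('v \<Rightarrow> 'w) \<Rightarrow> ('v \<times> 'w) set"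
  where "graph_of f = {(u, f u) |u. True}"

lemma hom_lie_superalgebra_direct_sum:
  fixes scale1 :: "'k::field \<Rightarrow> 'v::ab_group_add \<Rightarrow> 'v"
    and scale2 :: "'k \<Rightarrow> 'w::ab_group_add \<Rightarrow> 'w"
  assumes "hom_lie_superalgebra scale1 V1 br1 \<alpha>"
    and "hom_lie_superalgebra scale2 V2 br2 \<beta>"
  shows "hom_lie_superalgebra (module_prod.scale scale1 scale2) (direct_sum_grading V1 V2)
    (direct_sum_bracket br1 br2) (map_prod \<alpha> \<beta>)"
proof -
  interpret L: hom_lie_superalgebra scale1 V1 br1 \<alpha> by fact
  interpret G: hom_lie_superalgebra scale2 V2 br2 \<beta> by fact
  interpret P: vector_space_prod scale1 scale2 ..
  have sv: "super_vector_space P.scale (direct_sum_grading V1 V2)"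
  proof
    show "P.p.subspace (direct_sum_grading V1 V2 a)" for a
      unfolding direct_sum_grading_def
      by (intro P.subspace_Times L.subspace_component G.subspace_component)
    show "direct_sum_grading V1 V2 0 \<inter> direct_sum_grading V1 V2 1 = {0}"
      using L.component_Int G.component_Int
      by (auto simp: direct_sum_grading_def zero_prod_def)
    fix x :: "'v \<times> 'w"
    obtain y z y' z' where "y \<in> V1 0" "z \<in> V1 1" "fst x = y + z"
      "y' \<in> V2 0" "z' \<in> V2 1" "snd x = y' + z'"
      using L.component_sum[of "fst x"] G.component_sum[of "snd x"] by blast
    then show "\<exists>y\<in>direct_sum_grading V1 V2 0. \<exists>z\<in>direct_sum_grading V1 V2 1. x = y + z"
      by (intro bexI[of _ "(y, y')"] bexI[of _ "(z, z')"])
        (auto simp: direct_sum_grading_def prod_eq_iff)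
  qed
  interpret S: super_vector_space P.scale "direct_sum_grading V1 V2" by (fact sv)
  have lin: "Vector_Spaces.linear P.scale P.scale (\<lambda>p. (f (fst p), g (snd p)))"
    if "Vector_Spaces.linear scale1 scale1 f" "Vector_Spaces.linear scale2 scale2 g" for f g
    using that
    by (auto simp: module_hom_iff_linear[symmetric] module_hom_iff P.scale_def
        P.p.module_axioms)
  show ?thesis
  proof (intro hom_lie_superalgebra.intro even_linear_map.intro sv
      hom_lie_superalgebra_axioms.intro even_linear_map_axioms.intro)
    show "Vector_Spaces.linear P.scale P.scale (map_prod \<alpha> \<beta>)"
      using lin[OF L.twist.linear_axioms G.twist.linear_axioms]
      by (simp add: map_prod_def case_prod_beta')
    show "Vector_Spaces.linear P.scale P.scale (direct_sum_bracket br1 br2 x)" for x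
      using lin[OF L.linear_br_right G.linear_br_right]
      by (simp add: direct_sum_bracket_def[abs_def])
    show "Vector_Spaces.linear P.scale P.scale (\<lambda>x. direct_sum_bracket br1 br2 x y)" for y
      using lin[OF L.linear_br_left G.linear_br_left]
      by (simp add: direct_sum_bracket_def[abs_def])
  next
    fix x y :: "'v \<times> 'w" and a b
    assume "x \<in> direct_sum_grading V1 V2 a" "y \<in> direct_sum_grading V1 V2 b"
    then show "direct_sum_bracket br1 br2 x y
        = - P.scale (parity_sign (a * b)) (direct_sum_bracket br1 br2 y x)"
      using L.super_skew_symmetric[of "fst x" a "fst y" b]
        G.super_skew_symmetric[of "snd x" a "snd y" b]
      by (auto simp: direct_sum_grading_def direct_sum_bracket_def P.scale_def)
  next
    fix x y :: "'v \<times> 'w" and a b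
    assume "x \<in> direct_sum_grading V1 V2 a" "y \<in> direct_sum_grading V1 V2 b"
    then show "direct_sum_bracket br1 br2 x y \<in> direct_sum_grading V1 V2 (a + b)"
      unfolding direct_sum_grading_def direct_sum_bracket_def mem_Times_iff fst_conv snd_conv
      by (intro conjI L.br_even G.br_even) simp_all
  next
    fix x y z :: "'v \<times> 'w" and a b c
    assume "x \<in> direct_sum_grading V1 V2 a" "y \<in> direct_sum_grading V1 V2 b"
      "z \<in> direct_sum_grading V1 V2 c"
    then show "P.scale (parity_sign (a * c))
          (direct_sum_bracket br1 br2 (map_prod \<alpha> \<beta> x) (direct_sum_bracket br1 br2 y z))
        + P.scale (parity_sign (b * a))
          (direct_sum_bracket br1 br2 (map_prod \<alpha> \<beta> y) (direct_sum_bracket br1 br2 z x))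
        + P.scale (parity_sign (c * b))
          (direct_sum_bracket br1 br2 (map_prod \<alpha> \<beta> z) (direct_sum_bracket br1 br2 x y)) = 0"
      using L.hom_Jacobi[of "fst x" a "fst y" b "fst z" c]
        G.hom_Jacobi[of "snd x" a "snd y" b "snd z" c]
      by (simp add: direct_sum_grading_def direct_sum_bracket_def P.scale_def mem_Times_iff
          zero_prod_def)
  qed (auto simp: direct_sum_grading_def intro: L.twist.even G.twist.even)
qed

end

theory Submission
  imports Defs
begin

text \<open>
  A pair lies in the graph of \<open>\<phi>\<close> exactly when its second component is the image of its first.
  The operations of the direct sum act componentwise, so each closure condition on the graph,
  read on the second component, is one of the morphism equations:
  \<open>(\<alpha> u, \<beta> (\<phi> u))\<close> lies in the graph iff \<open>\<beta> (\<phi> u) = \<phi> (\<alpha> u)\<close>, and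
  \<open>([u, v], [\<phi> u, \<phi> v])\<close> lies in it iff \<open>[\<phi> u, \<phi> v] = \<phi> [u, v]\<close>.

  The only other requirement on a hom-Lie sub-superalgebra is that it be a graded subspace, and
  the graph of an even linear map always is one: linearity makes the graph a subspace
  (\<open>subspace_graph\<close>), and evenness makes it contain the homogeneous parts of its elements
  (\<open>graph_homogeneous_decomposition\<close>).
\<close>

lemma mem_graph_of_iff: "p \<in> graph_of f \<longleftrightarrow> snd p = f (fst p)"
  by (cases p) (auto simp: graph_of_def)

lemma subspace_graph:
  assumes "Vector_Spaces.linear scale1 scale2 f"
  shows "module.subspace (module_prod.scale scale1 scale2) (graph_of f)"
proof -
  interpret Vector_Spaces.linear scale1 scale2 f by fact
  interpret P: vector_space_prod scale1 scale2 ..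
  show ?thesis
    by (simp add: P.p.subspace_def mem_graph_of_iff P.scale_def add scale)
qed

text \<open>If \<open>u = y + z\<close> with \<open>y\<close> even and \<open>z\<close> odd, then \<open>(u, f u) = (y, f y) + (z, f z)\<close>. Both summands
  lie in the graph, and they are homogeneous because \<open>f\<close> preserves degrees.\<close>

lemma (in even_linear_map) graph_homogeneous_decomposition:
  assumes "p \<in> graph_of f"
  shows "\<exists>q\<in>graph_of f \<inter> direct_sum_grading V1 V2 0.
    \<exists>r\<in>graph_of f \<inter> direct_sum_grading V1 V2 1. p = q + r"
proof -
  obtain y z where yz: "y \<in> V1 0" "z \<in> V1 1" "fst p = y + z"
    using dom.component_sum by blast
  have "p = (y, f y) + (z, f z)"
    using assms yz by (simp add: prod_eq_iff mem_graph_of_iff add)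
  moreover have "(y, f y) \<in> graph_of f \<inter> direct_sum_grading V1 V2 0"
    "(z, f z) \<in> graph_of f \<inter> direct_sum_grading V1 V2 1"
    using yz by (auto simp: mem_graph_of_iff direct_sum_grading_def intro: even)
  ultimately show ?thesis by blast
qed

lemma twist_closed_graph_iff:
  "map_prod \<alpha> \<beta> ` graph_of f \<subseteq> graph_of f \<longleftrightarrow> f \<circ> \<alpha> = \<beta> \<circ> f"
  by (auto simp: image_subset_iff graph_of_def fun_eq_iff)

lemma br_closed_graph_iff:
  "(\<forall>p\<in>graph_of f. \<forall>q\<in>graph_of f. direct_sum_bracket br1 br2 p q \<in> graph_of f) \<longleftrightarrow>
    (\<forall>u v. f (br1 u v) = br2 (f u) (f v))"
  by (auto simp: graph_of_def direct_sum_bracket_def)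

theorem proposition2p4:
  fixes scaleL :: "'k::field \<Rightarrow> 'v::ab_group_add \<Rightarrow> 'v"
    and L :: "bit \<Rightarrow> 'v set"
    and brL :: "'v \<Rightarrow> 'v \<Rightarrow> 'v"
    and \<alpha> :: "'v \<Rightarrow> 'v"
    and scaleG :: "'k \<Rightarrow> 'w::ab_group_add \<Rightarrow> 'w"
    and G :: "bit \<Rightarrow> 'w set"
    and brG :: "'w \<Rightarrow> 'w \<Rightarrow> 'w"
    and \<beta> :: "'w \<Rightarrow> 'w"
    and \<phi> :: "'v \<Rightarrow> 'w"
  assumes "hom_lie_superalgebra scaleL L brL \<alpha>"
    and "hom_lie_superalgebra scaleG G brG \<beta>"
    and "even_linear_map scaleL L scaleG G \<phi>"
  shows "hom_lie_superalgebra_morphism scaleL L brL \<alpha> scaleG G brG \<beta> \<phi> \<longleftrightarrow>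
    hom_lie_sub_superalgebra (module_prod.scale scaleL scaleG) (direct_sum_grading L G)
      (direct_sum_bracket brL brG) (map_prod \<alpha> \<beta>) (graph_of \<phi>)"
proof -
  interpret \<phi>: even_linear_map scaleL L scaleG G \<phi> by fact
  interpret S: hom_lie_superalgebra "module_prod.scale scaleL scaleG" "direct_sum_grading L G"
      "direct_sum_bracket brL brG" "map_prod \<alpha> \<beta>"
    by (rule hom_lie_superalgebra_direct_sum) fact+
  have graded: "S.graded_subspace (graph_of \<phi>)"
    unfolding S.graded_subspace_def
    using subspace_graph[OF \<phi>.linear_axioms] \<phi>.graph_homogeneous_decomposition by blast
  have "hom_lie_superalgebra_morphism scaleL L brL \<alpha> scaleG G brG \<beta> \<phi> \<longleftrightarrow>
      (\<forall>u v. \<phi> (brL u v) = brG (\<phi> u) (\<phi> v)) \<and> \<phi> \<circ> \<alpha> = \<beta> \<circ> \<phi>"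
    using assms
    by (simp add: hom_lie_superalgebra_morphism_def hom_lie_superalgebra_morphism_axioms_def)
  also have "\<dots> \<longleftrightarrow> hom_lie_sub_superalgebra (module_prod.scale scaleL scaleG)
      (direct_sum_grading L G) (direct_sum_bracket brL brG) (map_prod \<alpha> \<beta>) (graph_of \<phi>)"
    unfolding hom_lie_sub_superalgebra_def hom_lie_sub_superalgebra_axioms_def
      twist_closed_graph_iff br_closed_graph_iff[symmetric]
    using graded S.hom_lie_superalgebra_axioms by blast
  finally show ?thesis .
qed

end
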